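(* Suppose Assumptions 1 and 2 (listed in the context) hold and $\overline{\epsilon}<\frac{m}{L}$. Let $\{x^k\}$ be generated by the VBPG method, let $\bar{x}$ be an accumulation point of $\{x^k\}$, put $\bar F=F(\bar x)$, and suppose that the VP-EB condition holds at $\bar{x}$ with constants $\kappa',\eta,\nu>0$. Then $\{F(x^k)\}$ converges to $\bar F$ at the $Q$-linear rate: there are $\beta\in(0,1)$ and $k_0$ such that $$F(x^{k+1})-\bar F\le\beta\,(F(x^k)-\bar F)\qquad\forall k\ge k_0.$$ Moreover, $\{x^k\}$ converges at the $R$-linear rate to the critical point $\bar x$, which is either a limiting critical point or a proximal critical point of $F$.
   Context: $\langle\cdot,\cdot\rangle,\|\cdot\|$ are the Euclidean inner product and norm on $\mathbb{R}^n$; $\mathbb{B}(\bar x;\eta)$ is the open ball of radius $\eta$ centered at $\bar x$. $F=f+g$. Assumption 1: (i) $f:\mathbb{R}^n\to(-\infty,\infty]$ is proper lower semicontinuous (l.s.c.), differentiable on $\mathrm{dom} f$, $\mathrm{dom} f$ is convex, and $\nabla f$ is $L$-Lipschitz ($L>0$); (ii) $g:\mathbb{R}^n\to(-\infty,\infty]$ is proper l.s.c. and $\mathrm{dom}\,g$ is convex; (iii) $F$ is level-bounded: $\{x: F(x)\le r\}$ is bounded (possibly empty) for every $r\in\mathbb{R}$. Assumption 2: for each $k\in\mathbb{N}$, $K^k:\mathbb{R}^n\to\mathbb{R}$ is differentiable, strongly convex with uniform modulus $m>0$, and $\nabla K^k$ is uniformly $M$-Lipschitz; $0<\underline{\epsilon}\le\epsilon^k\le\overline{\epsilon}$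 for all $k$. Bregman distances: $D^k(x,y)=K^k(y)-[K^k(x)+\langle\nabla K^k(x),y-x\rangle]$. VBPG method: from an initial point $x^0$, for all $k\ge0$, $x^{k+1}\in\operatorname{argmin}_{x\in\mathbb{R}^n}\{\langle\nabla f(x^k),x-x^k\rangle+g(x)+\frac{1}{\epsilon^k}D^k(x^k,x)\}$. ($f$ is understood to be finite and differentiable where $\nabla f$ is used.) $\mathfrak{B}(\bar x;\eta,\nu)=\mathbb{B}(\bar x;\eta)\cap\{x:\bar F<F(x)<\bar F+\nu\}$. VP-EB (value proximity error bound) at $\bar x$ with $\kappa',\eta,\nu>0$: $F(x^{k+1})-F(\bar x)\le\kappa'\|x^k-x^{k+1}\|^2$ for every $k$ with $x^{k+1}\in\mathfrak{B}(\bar x;\eta,\nu)$. $R$-linear convergence of $x^k$ to $\bar x$: there are $C>0$ and $q\in(0,1)$ with $\|x^k-\bar x\|\le Cq^k$ for all large $k$. Subdifferentials at $\bar x\in\mathrm{dom}\,\psi$: $\partial_P\psi(\bar x)$ (proximal) is the set of $\xi$ for which there are $\rho>0,\delta>0$ with $\psi(x)\ge\psi(\bar x)+\langle\xi,x-\bar x\rangle-\rho\|x-\bar x\|^2$ whenever $\|x-\bar x\|<\delta$; $\partial_F\psi(\bar x)$ (Fréchet) is the set of $\xi$ with $\liminf_{x\to\bar x,x\ne\bar x}\|x-\bar x\|^{-1}[\psi(x)-\psi(\bar x)-\langle\xi,x-\bar x\rangle]\ge0$; $\partial_L\psi(\bar x)$ (limiting) is the set of limits of $\xi_n\in\partial_F\psi(x_n)$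 with $x_n\to\bar x$, $\psi(x_n)\to\psi(\bar x)$. A proximal critical point satisfies $0\in\partial_PF(x)$; a limiting critical point satisfies $0\in\nabla f(x)+\partial_Lg(x)$. *)

theory Defs
  imports "HOL-Analysis.Analysis"
begin

(* Functions into the half-open line (-infinity, +infinity] are ereal-valued functions that
   never take the value -infinity; the latter is part of "proper". *)

definition edom :: "('a \<Rightarrow> ereal) \<Rightarrow> 'a set" where
  "edom \<psi> = {x. \<psi> x < \<infinity>}"

definition proper :: "('a \<Rightarrow> ereal) \<Rightarrow> bool" where
  "proper \<psi> \<longleftrightarrow> (\<forall>x. \<psi> x \<noteq> -\<infinity>) \<and> edom \<psi> \<noteq> {}"

definition lsc :: "('a::topological_space \<Rightarrow> ereal) \<Rightarrow> bool" where
  "lsc \<psi> \<longleftrightarrow> (\<forall>x. \<psi> x \<le> Liminf (at x) \<psi>)"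

definition level_bounded :: "('a::metric_space \<Rightarrow> ereal) \<Rightarrow> bool" where
  "level_bounded \<psi> \<longleftrightarrow> (\<forall>r::real. bounded {x. \<psi> x \<le> ereal r})"

(* Differentiability of an extended-valued function on its domain, with gradient G.  The
   derivative is taken relative to the domain: for interior points of the domain this is the
   usual gradient, and the domain itself is not required to be open. *)
definition has_gradient_on_dom ::
    "('a::real_inner \<Rightarrow> ereal) \<Rightarrow> ('a \<Rightarrow> 'a) \<Rightarrow> bool" where
  "has_gradient_on_dom f G \<longleftrightarrow>
     (\<forall>x\<in>edom f. ((\<lambda>y. real_of_ereal (f y)) has_derivative (\<lambda>h. h \<bullet> G x)) (at x within edom f))"

definition strongly_convex :: "real \<Rightarrow> ('a::real_inner \<Rightarrow> real) \<Rightarrow> bool" where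
  "strongly_convex m K \<longleftrightarrow>
     (\<forall>x y. \<forall>t\<in>{0..1}. K (t *\<^sub>R x + (1 - t) *\<^sub>R y)
        \<le> t * K x + (1 - t) * K y - m / 2 * t * (1 - t) * (norm (x - y))\<^sup>2)"

definition bregman :: "('a::real_inner \<Rightarrow> real) \<Rightarrow> ('a \<Rightarrow> 'a) \<Rightarrow> 'a \<Rightarrow> 'a \<Rightarrow> real" where
  "bregman K gradK x y = K y - (K x + gradK x \<bullet> (y - x))"

(* The first conjunct makes the use of the gradient of f at every iterate meaningful; the
   minimisation step alone only puts the iterates into the domain of g. *)
definition vbpg ::
    "('a::real_inner \<Rightarrow> ereal) \<Rightarrow> ('a \<Rightarrow> 'a) \<Rightarrow> ('a \<Rightarrow> ereal) \<Rightarrow>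
     (nat \<Rightarrow> 'a \<Rightarrow> real) \<Rightarrow> (nat \<Rightarrow> 'a \<Rightarrow> 'a) \<Rightarrow> (nat \<Rightarrow> real) \<Rightarrow> (nat \<Rightarrow> 'a) \<Rightarrow> bool" where
  "vbpg f gradf g K gradK \<epsilon> x \<longleftrightarrow>
     (\<forall>k. x k \<in> edom f) \<and>
     (\<forall>k. is_arg_min
        (\<lambda>y. ereal (gradf (x k) \<bullet> (y - x k)) + g y + ereal (1 / \<epsilon> k * bregman (K k) (gradK k) (x k) y))
        (\<lambda>y. True) (x (Suc k)))"

definition accumulation_point :: "(nat \<Rightarrow> 'a::topological_space) \<Rightarrow> 'a \<Rightarrow> bool" where
  "accumulation_point x a \<longleftrightarrow> (\<exists>r. strict_mono r \<and> (x \<circ> r) \<longlonglongrightarrow> a)"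

definition value_ball :: "('a::metric_space \<Rightarrow> ereal) \<Rightarrow> 'a \<Rightarrow> real \<Rightarrow> real \<Rightarrow> 'a set" where
  "value_ball F a \<eta> \<nu> = ball a \<eta> \<inter> {y. F a < F y \<and> F y < F a + ereal \<nu>}"

definition vp_eb ::
    "('a::real_normed_vector \<Rightarrow> ereal) \<Rightarrow> (nat \<Rightarrow> 'a) \<Rightarrow> 'a \<Rightarrow> real \<Rightarrow> real \<Rightarrow> real \<Rightarrow> bool" where
  "vp_eb F x a \<kappa> \<eta> \<nu> \<longleftrightarrow>
     (\<forall>k. x (Suc k) \<in> value_ball F a \<eta> \<nu> \<longrightarrow>
        F (x (Suc k)) - F a \<le> ereal (\<kappa> * (norm (x k - x (Suc k)))\<^sup>2))"

definition r_linear_conv :: "(nat \<Rightarrow> 'a::real_normed_vector) \<Rightarrow> 'a \<Rightarrow> bool" where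
  "r_linear_conv x a \<longleftrightarrow>
     (\<exists>C>0. \<exists>q. 0 < q \<and> q < 1 \<and> (\<forall>\<^sub>F k in sequentially. norm (x k - a) \<le> C * q ^ k))"

definition prox_subdiff :: "('a::real_inner \<Rightarrow> ereal) \<Rightarrow> 'a \<Rightarrow> 'a set" where
  "prox_subdiff \<psi> a = {\<xi>. a \<in> edom \<psi> \<and>
     (\<exists>\<rho>>0. \<exists>\<delta>>0. \<forall>x. norm (x - a) < \<delta> \<longrightarrow>
        \<psi> x \<ge> \<psi> a + ereal (\<xi> \<bullet> (x - a)) - ereal (\<rho> * (norm (x - a))\<^sup>2))}"

definition frechet_subdiff :: "('a::real_inner \<Rightarrow> ereal) \<Rightarrow> 'a \<Rightarrow> 'a set" where
  "frechet_subdiff \<psi> a = {\<xi>. a \<in> edom \<psi> \<and>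
     Liminf (at a) (\<lambda>x. ereal (1 / norm (x - a)) * (\<psi> x - \<psi> a - ereal (\<xi> \<bullet> (x - a)))) \<ge> 0}"

definition limiting_subdiff :: "('a::real_inner \<Rightarrow> ereal) \<Rightarrow> 'a \<Rightarrow> 'a set" where
  "limiting_subdiff \<psi> a = {\<xi>. a \<in> edom \<psi> \<and>
     (\<exists>y \<zeta>. (\<forall>n::nat. \<zeta> n \<in> frechet_subdiff \<psi> (y n)) \<and>
        y \<longlonglongrightarrow> a \<and> (\<lambda>n. \<psi> (y n)) \<longlonglongrightarrow> \<psi> a \<and> \<zeta> \<longlonglongrightarrow> \<xi>)}"

definition prox_critical :: "('a::real_inner \<Rightarrow> ereal) \<Rightarrow> 'a \<Rightarrow> bool" where
  "prox_critical F a \<longleftrightarrow> 0 \<in> prox_subdiff F a"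

definition limiting_critical ::
    "('a::real_inner \<Rightarrow> ereal) \<Rightarrow> ('a \<Rightarrow> 'a) \<Rightarrow> ('a \<Rightarrow> ereal) \<Rightarrow> 'a \<Rightarrow> bool" where
  "limiting_critical f gradf g a \<longleftrightarrow>
     a \<in> edom f \<and> 0 \<in> (\<lambda>\<xi>. gradf a + \<xi>) ` limiting_subdiff g a"

end

theory Submission
  imports Defs
begin

text \<open>Testing the minimality of \<open>x (Suc k)\<close> against \<open>x k\<close> shows that \<open>F\<close> decreases by at least a
  multiple of the squared step length.  Testing it against \<open>xbar\<close> bounds the limit of the values by
  \<open>F xbar\<close>, and lower semicontinuity gives the converse, so \<open>F (x k)\<close> tends to \<open>F xbar\<close>; the error
  bound then turns the decrease into a contraction.  Testing it against an arbitrary point and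
  passing to the limit yields a global quadratic minorant of \<open>F\<close> touching it at \<open>xbar\<close>, so that
  \<open>xbar\<close> is always a proximal critical point.\<close>

section \<open>Quadratic bounds from Lipschitz gradients and strong convexity\<close>

text \<open>Convexity keeps the segment from \<open>x\<close> to \<open>y\<close> inside
  \<open>S\<close>, and along it the slope of \<open>h\<close> drifts from its initial value by at
  most \<open>L * t\<close> times the squared length; integrating the drift gives the factor
  \<open>L / 2\<close>. Derivatives are taken within \<open>S\<close> because the domain of
  \<open>f\<close> need not be open.\<close>

lemma lipschitz_gradient_quadratic_bound:
  fixes h :: "'a::real_inner \<Rightarrow> real"
  assumes S: "convex S" and xS: "x \<in> S" and yS: "y \<in> S"
    and der: "\<And>z. z \<in> S \<Longrightarrow> (h has_derivative (\<lambda>v. v \<bullet> G z)) (at z within S)"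
    and lip: "L-lipschitz_on S G"
  shows "\<bar>h y - h x - G x \<bullet> (y - x)\<bar> \<le> L / 2 * (norm (y - x))\<^sup>2"
proof -
  define p where "p t = x + t *\<^sub>R (y - x)" for t :: real
  have pS: "p t \<in> S" if "t \<in> {0..1}" for t
  proof -
    have "p t = (1 - t) *\<^sub>R x + t *\<^sub>R y"
      by (simp add: p_def algebra_simps)
    then show ?thesis
      using that convexD_alt[OF S xS yS, of t] by simp
  qed
  have dp: "((\<lambda>t. h (p t)) has_real_derivative (y - x) \<bullet> G (p t)) (at t within {0..1})"
    if t: "t \<in> {0..1}" for t
  proof -
    have 1: "(p has_derivative (\<lambda>s. s *\<^sub>R (y - x))) (at t within {0..1})"
      unfolding p_def by (auto intro!: derivative_eq_intros)
    have "((\<lambda>t. h (p t)) has_derivative (\<lambda>s. (s *\<^sub>R (y - x)) \<bullet> G (p t))) (at t within {0..1})"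
      by (rule has_derivative_in_compose2[where t = S and g = h and g' = "\<lambda>z v. v \<bullet> G z"])
        (use der pS t 1 in auto)
    then show ?thesis
      by (simp add: has_field_derivative_def mult_commute_abs)
  qed
  have gb: "\<bar>(y - x) \<bullet> G (p t) - (y - x) \<bullet> G x\<bar> \<le> L * t * (norm (y - x))\<^sup>2"
    if t: "t \<in> {0..1}" for t
  proof -
    have "\<bar>(y - x) \<bullet> (G (p t) - G x)\<bar> \<le> norm (y - x) * norm (G (p t) - G x)"
      by (rule Cauchy_Schwarz_ineq2)
    also have "\<dots> \<le> norm (y - x) * (L * norm (p t - x))"
      using lipschitz_onD[OF lip pS[OF t] xS] by (intro mult_left_mono) (auto simp: dist_norm)
    also have "\<dots> = L * t * (norm (y - x))\<^sup>2"
      using t by (simp add: p_def power2_eq_square)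
    finally show ?thesis
      by (simp add: inner_diff_right)
  qed
  \<comment> \<open>The sign \<open>\<sigma>\<close> treats both one-sided bounds at once. By
    \<open>gb\<close> the derivative of \<open>u \<sigma>\<close> is nonpositive on the open
    interval, so comparing the endpoint values replaces an integration.\<close>
  define u where "u \<sigma> t = \<sigma> * (h (p t) - t * ((y - x) \<bullet> G x)) - L / 2 * t\<^sup>2 * (norm (y - x))\<^sup>2"
    for \<sigma> t :: real
  have du: "(u \<sigma> has_real_derivative
      \<sigma> * ((y - x) \<bullet> G (p t) - (y - x) \<bullet> G x) - L * t * (norm (y - x))\<^sup>2) (at t within {0..1})"
    if "t \<in> {0..1}" for \<sigma> t
    unfolding u_def using dp[OF that]
    by (auto intro!: derivative_eq_intros simp: algebra_simps)
  have "u \<sigma> 1 \<le> u \<sigma> 0" if s: "\<sigma> = 1 \<or> \<sigma> = -1" for \<sigma>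
  proof (rule DERIV_nonpos_imp_decreasing_open[of 0 1 "u \<sigma>"])
    fix t :: real assume t: "0 < t" "t < 1"
    have "(u \<sigma> has_real_derivative
      \<sigma> * ((y - x) \<bullet> G (p t) - (y - x) \<bullet> G x) - L * t * (norm (y - x))\<^sup>2) (at t)"
      using du[of t \<sigma>] t at_within_Icc_at[of 0 t 1] by simp
    moreover have "\<sigma> * ((y - x) \<bullet> G (p t) - (y - x) \<bullet> G x) - L * t * (norm (y - x))\<^sup>2 \<le> 0"
      using gb[of t] t s by auto
    ultimately show "\<exists>D. (u \<sigma> has_real_derivative D) (at t) \<and> D \<le> 0"
      by blast
  next
    show "continuous_on {0..1} (u \<sigma>)"
      using du by (rule DERIV_continuous_on)
  qed simp
  from this[of 1] this[of "-1"] show ?thesis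
    by (intro abs_leI) (simp_all add: u_def p_def inner_commute)
qed

text \<open>Subtract \<open>K x\<close> from the convexity inequality on the segment, divide by
  \<open>t\<close> and let \<open>t\<close> decrease to 0: the difference quotient becomes the
  directional derivative, and the factor \<open>1 - t\<close> in the quadratic term becomes
  1.\<close>

lemma strongly_convex_bregman_ge:
  fixes K :: "'a::real_inner \<Rightarrow> real"
  assumes sc: "strongly_convex m K" and d: "GDERIV K x :> gK x"
  shows "m / 2 * (norm (y - x))\<^sup>2 \<le> bregman K gK x y"
proof -
  have "((\<lambda>t. K (x + t *\<^sub>R (y - x))) has_derivative (\<lambda>s. (s *\<^sub>R (y - x)) \<bullet> gK x)) (at 0)"
  proof (rule has_derivative_compose[of "\<lambda>t. x + t *\<^sub>R (y - x)"])
    show "((\<lambda>t. x + t *\<^sub>R (y - x)) has_derivative (\<lambda>s. s *\<^sub>R (y - x))) (at 0)"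
      by (auto intro!: derivative_eq_intros)
    show "(K has_derivative (\<lambda>h. h \<bullet> gK x)) (at (x + 0 *\<^sub>R (y - x)))"
      using d by (simp add: gderiv_def)
  qed
  then have "((\<lambda>t. K (x + t *\<^sub>R (y - x))) has_real_derivative (y - x) \<bullet> gK x) (at 0)"
    by (simp add: has_field_derivative_def mult_commute_abs)
  then have lim: "((\<lambda>t. (K (x + t *\<^sub>R (y - x)) - K x) / t) \<longlongrightarrow> (y - x) \<bullet> gK x) (at_right 0)"
    unfolding DERIV_def by (auto intro: tendsto_mono[OF at_le])
  have "((\<lambda>t. K y - K x - m / 2 * (1 - t) * (norm (y - x))\<^sup>2) \<longlongrightarrow>
      K y - K x - m / 2 * (1 - 0) * (norm (y - x))\<^sup>2) (at_right (0::real))"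
    by (intro tendsto_intros)
  moreover have "eventually (\<lambda>t. (K (x + t *\<^sub>R (y - x)) - K x) / t
      \<le> K y - K x - m / 2 * (1 - t) * (norm (y - x))\<^sup>2) (at_right (0::real))"
    unfolding eventually_at_right_field
  proof (intro exI[of _ 1] conjI allI impI)
    fix t :: real assume t: "0 < t" "t < 1"
    have "K (t *\<^sub>R y + (1 - t) *\<^sub>R x)
        \<le> t * K y + (1 - t) * K x - m / 2 * t * (1 - t) * (norm (y - x))\<^sup>2"
      using sc t unfolding strongly_convex_def by auto
    moreover have "t *\<^sub>R y + (1 - t) *\<^sub>R x = x + t *\<^sub>R (y - x)"
      by (simp add: algebra_simps)
    ultimately show "(K (x + t *\<^sub>R (y - x)) - K x) / t
        \<le> K y - K x - m / 2 * (1 - t) * (norm (y - x))\<^sup>2"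
      using t by (simp add: field_simps)
  qed simp
  ultimately have "(y - x) \<bullet> gK x \<le> K y - K x - m / 2 * (1 - 0) * (norm (y - x))\<^sup>2"
    using lim by (intro tendsto_le[of "at_right (0::real)"]) auto
  then show ?thesis
    by (simp add: bregman_def inner_commute)
qed

lemma lipschitz_bregman_le:
  fixes K :: "'a::real_inner \<Rightarrow> real"
  assumes "\<And>z. GDERIV K z :> gK z" "M-lipschitz_on UNIV gK"
  shows "bregman K gK x y \<le> M / 2 * (norm (y - x))\<^sup>2"
proof -
  have "\<bar>K y - K x - gK x \<bullet> (y - x)\<bar> \<le> M / 2 * (norm (y - x))\<^sup>2"
    using lipschitz_gradient_quadratic_bound[of UNIV x y K gK M] assms by (simp add: gderiv_def)
  then show ?thesis
    unfolding bregman_def by linarith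
qed

section \<open>Lower semicontinuity along sequences\<close>

text \<open>The \<open>Liminf\<close> in \<open>lsc\<close> is over the punctured filter
  \<open>at a\<close>; the assumption supplies the point \<open>a\<close> itself.\<close>

lemma lsc_eventually_gt:
  assumes "lsc \<psi>" "z < \<psi> a"
  shows "eventually (\<lambda>y. z < \<psi> y) (nhds a)"
proof -
  have "\<psi> a \<le> Liminf (at a) \<psi>"
    using assms by (simp add: lsc_def)
  then have "eventually (\<lambda>y. z < \<psi> y) (at a)"
    using assms(2) le_Liminf_iff[of "\<psi> a" "at a" \<psi>] by auto
  then show ?thesis
    using assms(2) by (simp add: eventually_nhds_conv_at)
qed

lemma lsc_le_of_frequently_le:
  assumes "lsc \<psi>" "y \<longlonglongrightarrow> a" "\<exists>\<^sub>F j in sequentially. \<psi> (y j) \<le> c"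
  shows "\<psi> a \<le> c"
proof (rule ccontr)
  assume "\<not> \<psi> a \<le> c"
  then have "eventually (\<lambda>z. c < \<psi> z) (nhds a)"
    using lsc_eventually_gt[OF assms(1), of c a] by simp
  then have "eventually (\<lambda>j. c < \<psi> (y j)) sequentially"
    using assms(2) by (rule eventually_compose_filterlim)
  then have "eventually (\<lambda>j. \<not> \<psi> (y j) \<le> c) sequentially"
    by (simp add: not_le)
  then show False
    using assms(3) by (simp add: frequently_def)
qed

lemma proper_ereal_real:
  assumes "proper \<psi>" "a \<in> edom \<psi>"
  shows "\<psi> a = ereal (real_of_ereal (\<psi> a))"
  using assms by (cases "\<psi> a") (auto simp: proper_def edom_def)

section \<open>Linear convergence from sufficient decrease and an error bound\<close>

text \<open>Once an iterate is close to the accumulation point with a small value, the error bound makes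
  the values, and hence the squared step lengths, decay geometrically; the total length of the
  remaining steps is then too small to leave the ball on which the error bound holds.\<close>

lemma error_bound_linear_convergence:
  fixes x :: "nat \<Rightarrow> 'a::real_normed_vector" and h :: "nat \<Rightarrow> real"
  assumes a: "a > 0" and kap: "\<kappa> > 0" and eta: "\<eta> > 0" and nu: "\<nu> > 0"
    and dec: "\<And>k. k \<ge> N \<Longrightarrow> h (Suc k) + a * (norm (x k - x (Suc k)))\<^sup>2 \<le> h k"
    and lim: "h \<longlonglongrightarrow> 0"
    and acc: "accumulation_point x xbar"
    and eb: "\<And>k. k \<ge> N \<Longrightarrow> x (Suc k) \<in> ball xbar \<eta> \<Longrightarrow> 0 < h (Suc k) \<Longrightarrow> h (Suc k) < \<nu> \<Longrightarrow>
        h (Suc k) \<le> \<kappa> * (norm (x k - x (Suc k)))\<^sup>2"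
  shows "(\<exists>\<beta> k0. 0 < \<beta> \<and> \<beta> < 1 \<and> N \<le> k0 \<and> (\<forall>k\<ge>k0. h (Suc k) \<le> \<beta> * h k))
    \<and> r_linear_conv x xbar"
proof -
  have mono: "h (Suc k) \<le> h k" if "k \<ge> N" for k
    using dec[OF that] a by (smt (verit) mult_nonneg_nonneg zero_le_power2)
  have anti: "h l \<le> h k" if "N \<le> k" "k \<le> l" for k l
    using that(2) that(1) by (induction l rule: dec_induct) (use mono in \<open>auto intro: order_trans\<close>)
  have nonneg: "0 \<le> h k" if "N \<le> k" for k
    using lim by (rule LIMSEQ_le_const2) (use anti that in blast)
  \<comment> \<open>The error bound and the decrease give
    \<open>a * h (Suc k) \<le> \<kappa> * (h k - h (Suc k))\<close>; solving for
    \<open>h (Suc k)\<close> yields this factor. Step lengths scale like the square root of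
    \<open>h\<close>, hence the ratio \<open>q\<close>.\<close>
  define \<beta> where "\<beta> = \<kappa> / (\<kappa> + a)"
  define q where "q = sqrt \<beta>"
  have \<beta>: "0 < \<beta>" "\<beta> < 1"
    using a kap by (auto simp: \<beta>_def)
  have q: "0 < q" "q < 1" "q\<^sup>2 = \<beta>"
    using \<beta> by (auto simp: q_def)
  obtain r where r: "strict_mono r" and xr: "(\<lambda>j. x (r j)) \<longlonglongrightarrow> xbar"
    using acc by (auto simp: accumulation_point_def o_def)
  have r_top: "filterlim r at_top sequentially"
    using r by (rule filterlim_subseq)
  have hr: "(\<lambda>j. h (r j)) \<longlonglongrightarrow> 0"
    using lim r_top by (rule filterlim_compose)
  \<comment> \<open>This is the sum of a geometric series majorizing all later steps. Half of
    \<open>\<eta>\<close> is reserved for it and half for the distance of the starting iterate from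
    \<open>xbar\<close>.\<close>
  have "(\<lambda>j. sqrt (h (r j) / a) / (1 - q)) \<longlonglongrightarrow> sqrt (0 / a) / (1 - q)"
    using a q by (intro tendsto_intros hr) auto
  then have "eventually (\<lambda>j. sqrt (h (r j) / a) / (1 - q) < \<eta> / 2) sequentially"
    using eta by (intro order_tendstoD(2)) auto
  moreover have "eventually (\<lambda>j. h (r j) < \<nu>) sequentially"
    using hr nu by (rule order_tendstoD)
  moreover have "eventually (\<lambda>j. dist (x (r j)) xbar < \<eta> / 2) sequentially"
    using xr eta by (intro tendstoD) auto
  moreover have "eventually (\<lambda>j. N \<le> r j) sequentially"
    using r_top by (simp add: filterlim_at_top)
  ultimately have "eventually (\<lambda>j. sqrt (h (r j) / a) / (1 - q) < \<eta> / 2 \<and> h (r j) < \<nu>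
      \<and> dist (x (r j)) xbar < \<eta> / 2 \<and> N \<le> r j) sequentially"
    by eventually_elim auto
  then obtain n where n: "sqrt (h n / a) / (1 - q) < \<eta> / 2" "h n < \<nu>"
      "norm (x n - xbar) < \<eta> / 2" "N \<le> n"
    by (auto simp: eventually_sequentially dist_norm)
  define s where "s = sqrt (h n / a)"
  have s: "0 \<le> s"
    using nonneg[OF n(4)] a by (simp add: s_def)
  have contract: "h (Suc k) \<le> \<beta> * h k" if k: "n \<le> k" "x (Suc k) \<in> ball xbar \<eta>" for k
  \<comment> \<open>The error bound covers only strictly positive values; at value 0 the contraction
    is immediate.\<close>
  proof (cases "h (Suc k) = 0")
    case True
    then show ?thesis
      using nonneg[of k] k(1) n(4) \<beta> by simp
  next
    case False
    have "0 < h (Suc k)" "h (Suc k) < \<nu>"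
      using False nonneg[of "Suc k"] anti[of n "Suc k"] k n by auto
    then have "a * h (Suc k) \<le> a * (\<kappa> * (norm (x k - x (Suc k)))\<^sup>2)"
      using eb[of k] k n(4) a by simp
    also have "\<dots> = \<kappa> * (a * (norm (x k - x (Suc k)))\<^sup>2)"
      by simp
    also have "\<dots> \<le> \<kappa> * (h k - h (Suc k))"
      using dec[of k] k n(4) kap by (intro mult_left_mono) auto
    finally show ?thesis
      using a kap by (simp add: \<beta>_def field_simps)
  qed
  have step: "norm (x (n + i) - x (Suc (n + i))) \<le> s * q ^ i"
    if "h (n + i) \<le> \<beta> ^ i * h n" for i
  proof (rule power2_le_imp_le)
    have "a * (norm (x (n + i) - x (Suc (n + i))))\<^sup>2 \<le> \<beta> ^ i * h n"
      using dec[of "n + i"] nonneg[of "Suc (n + i)"] n(4) that by simp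
    moreover have "(s * q ^ i)\<^sup>2 = h n / a * \<beta> ^ i"
      using nonneg[OF n(4)] a q(3)
      by (simp add: s_def power_mult_distrib power_commutes flip: power_mult)
         (simp add: mult.commute[of i] power_mult)
    ultimately show "(norm (x (n + i) - x (Suc (n + i))))\<^sup>2 \<le> (s * q ^ i)\<^sup>2"
      using a by (simp add: pos_le_divide_eq mult.commute)
    show "0 \<le> s * q ^ i"
      using s q by simp
  qed
  have geo: "s * (1 - q ^ i) / (1 - q) + s * q ^ i = s * (1 - q ^ Suc i) / (1 - q)" for i
    using q by (simp add: field_simps)
  have geo_le: "s * (1 - q ^ i) / (1 - q) \<le> s / (1 - q)" for i
    using s q by (intro divide_right_mono mult_left_le) auto
  \<comment> \<open>The two claims need each other: the value bound controls the next step, that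
    step keeps the next iterate in the ball, and only there does \<open>contract\<close> apply. The
    fraction is the closed form of the partial geometric sum.\<close>
  have inv: "h (n + i) \<le> \<beta> ^ i * h n
      \<and> norm (x (n + i) - xbar) \<le> norm (x n - xbar) + s * (1 - q ^ i) / (1 - q)" for i
  proof (induction i)
    case (Suc i)
    have nrm: "norm (x (Suc (n + i)) - xbar)
        \<le> norm (x (n + i) - xbar) + norm (x (n + i) - x (Suc (n + i)))"
      using dist_triangle[of "x (Suc (n + i))" xbar "x (n + i)"]
      by (simp add: dist_norm norm_minus_commute)
    have n2: "norm (x (Suc (n + i)) - xbar) \<le> norm (x n - xbar) + s * (1 - q ^ Suc i) / (1 - q)"
      using nrm Suc step[of i] geo[of i] by linarith
    then have "norm (x (Suc (n + i)) - xbar) < \<eta>"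
      using geo_le[of "Suc i"] n(1,3) unfolding s_def by linarith
    then have "h (Suc (n + i)) \<le> \<beta> * h (n + i)"
      by (intro contract) (auto simp: dist_norm norm_minus_commute)
    also have "\<dots> \<le> \<beta> * (\<beta> ^ i * h n)"
      using Suc \<beta> by (intro mult_left_mono) auto
    finally show ?case
      using n2 by (simp add: mult.assoc)
  qed simp
  have near: "norm (x (n + i) - xbar) < \<eta>" for i
    using inv[of i] geo_le[of i] n(1,3) unfolding s_def by linarith
  have "h (Suc k) \<le> \<beta> * h k" if "n \<le> k" for k
    using contract[OF that] near[of "Suc k - n"] that
    by (auto simp: dist_norm norm_minus_commute)
  then have Q: "\<exists>\<beta> k0. 0 < \<beta> \<and> \<beta> < 1 \<and> N \<le> k0 \<and> (\<forall>k\<ge>k0. h (Suc k) \<le> \<beta> * h k)"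
    using \<beta> n(4) by blast
  have tail: "norm (x (n + i) - x (n + i + j)) \<le> q ^ i * (s * (1 - q ^ j) / (1 - q))" for i j
  proof (induction j)
    case (Suc j)
    have "norm (x (n + i) - x (n + i + Suc j))
        \<le> norm (x (n + i) - x (n + i + j)) + norm (x (n + i + j) - x (Suc (n + i + j)))"
      using norm_triangle_ineq[of "x (n + i) - x (n + i + j)" "x (n + i + j) - x (Suc (n + i + j))"]
      by simp
    also have "\<dots> \<le> q ^ i * (s * (1 - q ^ j) / (1 - q)) + s * q ^ (i + j)"
      using Suc step[of "i + j"] inv[of "i + j"] by (simp add: add.assoc)
    also have "\<dots> = q ^ i * (s * (1 - q ^ j) / (1 - q) + s * q ^ j)"
      by (simp add: power_add distrib_left)
    finally show ?case
      by (simp only: geo)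
  qed simp
  \<comment> \<open>Dividing by \<open>q ^ n\<close> turns \<open>q ^ (k - n)\<close> into
    \<open>q ^ k\<close>; the added 1 keeps \<open>C\<close> positive when
    \<open>s = 0\<close>.\<close>
  define C where "C = s / (1 - q) / q ^ n + 1"
  have "C > 0"
    using s q by (auto simp: C_def intro!: add_nonneg_pos)
  moreover have "norm (x k - xbar) \<le> C * q ^ k" if k: "n \<le> k" for k
  proof -
    \<comment> \<open>Comparing \<open>x k\<close> with later members of the subsequence and passing
      to the limit bounds its distance to \<open>xbar\<close>.\<close>
    have "eventually (\<lambda>j. norm (x k - x (r j)) \<le> q ^ (k - n) * (s / (1 - q))) sequentially"
      using r_top[unfolded filterlim_at_top, rule_format, of k]
    proof eventually_elim
      case (elim j)
      have "norm (x k - x (r j)) \<le> q ^ (k - n) * (s * (1 - q ^ (r j - k)) / (1 - q))"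
        using tail[of "k - n" "r j - k"] elim k by simp
      also have "\<dots> \<le> q ^ (k - n) * (s / (1 - q))"
        using q by (intro mult_left_mono geo_le) auto
      finally show ?case .
    qed
    moreover have "(\<lambda>j. norm (x k - x (r j))) \<longlonglongrightarrow> norm (x k - xbar)"
      by (intro tendsto_intros xr)
    ultimately have "norm (x k - xbar) \<le> q ^ (k - n) * (s / (1 - q))"
      by (intro tendsto_upperbound) auto
    also have "\<dots> = (s / (1 - q) / q ^ n) * q ^ k"
      using q k by (simp add: power_diff mult.commute)
    also have "\<dots> \<le> C * q ^ k"
      using q by (intro mult_right_mono) (auto simp: C_def)
    finally show ?thesis .
  qed
  ultimately have "r_linear_conv x xbar"
    unfolding r_linear_conv_def eventually_sequentially using q by blast
  with Q show ?thesis ..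
qed

theorem theorem3p1:
  fixes f g F :: "real ^ 'n \<Rightarrow> ereal"
    and gradf :: "real ^ 'n \<Rightarrow> real ^ 'n"
    and K :: "nat \<Rightarrow> real ^ 'n \<Rightarrow> real"
    and gradK :: "nat \<Rightarrow> real ^ 'n \<Rightarrow> real ^ 'n"
    and \<epsilon> :: "nat \<Rightarrow> real"
    and L m M eps_lo eps_up \<kappa> \<eta> \<nu> :: real
    and x :: "nat \<Rightarrow> real ^ 'n"
    and xbar :: "real ^ 'n"
  assumes F: "F = (\<lambda>y. f y + g y)"
    and f_proper: "proper f" and f_lsc: "lsc f" and f_dom: "convex (edom f)"
    and f_diff: "has_gradient_on_dom f gradf"
    and L_pos: "L > 0" and f_lip: "L-lipschitz_on (edom f) gradf"
    and g_proper: "proper g" and g_lsc: "lsc g" and g_dom: "convex (edom g)"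
    and F_level: "level_bounded F"
    and K_diff: "\<And>k y. GDERIV (K k) y :> gradK k y"
    and m_pos: "m > 0" and K_sc: "\<And>k. strongly_convex m (K k)"
    and K_lip: "\<And>k. M-lipschitz_on UNIV (gradK k)"
    and eps_pos: "0 < eps_lo" and eps_bounds: "\<And>k. eps_lo \<le> \<epsilon> k \<and> \<epsilon> k \<le> eps_up"
    and eps_small: "eps_up < m / L"
    and iterates: "vbpg f gradf g K gradK \<epsilon> x"
    and accum: "accumulation_point x xbar"
    and pos: "\<kappa> > 0" "\<eta> > 0" "\<nu> > 0"
    and eb: "vp_eb F x xbar \<kappa> \<eta> \<nu>"
  shows "((\<lambda>k. F (x k)) \<longlonglongrightarrow> F xbar)
    \<and> (\<exists>\<beta> k0. 0 < \<beta> \<and> \<beta> < 1 \<and>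
         (\<forall>k\<ge>k0. F (x (Suc k)) - F xbar \<le> ereal \<beta> * (F (x k) - F xbar)))
    \<and> r_linear_conv x xbar
    \<and> (limiting_critical f gradf g xbar \<or> prox_critical F xbar)"
proof -

  \<comment> \<open>Real-valued representatives of \<open>f\<close> and \<open>g\<close>\<close>
  note f_real = proper_ereal_real[OF f_proper] and g_real = proper_ereal_real[OF g_proper]
  \<comment> \<open>\<open>real_of_ereal\<close> sends \<infinity> to 0, so these represent
    \<open>f\<close> and \<open>g\<close> only on their domains.\<close>
  define fr gr where "fr y = real_of_ereal (f y)" and "gr y = real_of_ereal (g y)" for y
  have f_fr: "f y = ereal (fr y)" if "y \<in> edom f" for y
    using f_real[OF that] by (simp add: fr_def)
  have g_gr: "g y = ereal (gr y)" if "y \<in> edom g" for y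
    using g_real[OF that] by (simp add: gr_def)
  have fr_der: "(fr has_derivative (\<lambda>h. h \<bullet> gradf y)) (at y within edom f)" if "y \<in> edom f" for y
    using f_diff that unfolding has_gradient_on_dom_def fr_def by blast
  have fr_le: "fr z \<le> fr y + gradf y \<bullet> (z - y) + L / 2 * (norm (z - y))\<^sup>2"
    and fr_ge: "fr y + gradf y \<bullet> (z - y) - L / 2 * (norm (z - y))\<^sup>2 \<le> fr z"
    if "y \<in> edom f" "z \<in> edom f" for y z
    using lipschitz_gradient_quadratic_bound[OF f_dom that fr_der f_lip] by linarith+
  have fr_cont: "continuous_on (edom f) fr"
    using fr_der by (auto simp: continuous_on_eq_continuous_within intro: has_derivative_continuous)
  have gradf_cont: "continuous_on (edom f) gradf"
    using f_lip by (rule lipschitz_on_continuous_on)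

  \<comment> \<open>Consequences of one minimisation step\<close>
  have xf: "x k \<in> edom f" for k
    using iterates by (simp add: vbpg_def)
  have arg_min: "ereal (gradf (x k) \<bullet> (x (Suc k) - x k)) + g (x (Suc k))
        + ereal (1 / \<epsilon> k * bregman (K k) (gradK k) (x k) (x (Suc k)))
      \<le> ereal (gradf (x k) \<bullet> (y - x k)) + g y + ereal (1 / \<epsilon> k * bregman (K k) (gradK k) (x k) y)"
    for k y
    using iterates unfolding vbpg_def is_arg_min_def by (simp add: not_less)
  \<comment> \<open>A test point in the domain of \<open>g\<close> makes the minimal value finite.
    Nothing places \<open>x 0\<close> in that domain, so later statements about
    \<open>\<Phi>\<close> start at index 1.\<close>
  have xg: "x (Suc k) \<in> edom g" for k
  proof -
    obtain y where "y \<in> edom g"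
      using g_proper by (auto simp: proper_def)
    then show ?thesis
      using arg_min[of k y] g_gr[of y] by (cases "g (x (Suc k))") (auto simp: edom_def)
  qed
  have eps: "0 < \<epsilon> k" "0 < eps_up" for k
    using eps_pos eps_bounds[of k] by auto
  have M_nonneg: "0 \<le> M"
    using K_lip by (rule lipschitz_on_nonneg)
  define \<rho> where "\<rho> = M / (2 * eps_lo)"
  have \<rho>: "0 \<le> \<rho>"
    using M_nonneg eps_pos by (simp add: \<rho>_def)
  \<comment> \<open>Strong convexity bounds the Bregman term at the minimiser from below. The one at
    \<open>y\<close> is kept exact, since it vanishes for \<open>y = x k\<close>;
    \<open>opt_le\<close> later bounds it by \<open>\<rho>\<close> times a squared norm.\<close>
  have opt: "gr (x (Suc k)) + m / (2 * eps_up) * (norm (x k - x (Suc k)))\<^sup>2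
      \<le> gr y + gradf (x k) \<bullet> (y - x (Suc k)) + bregman (K k) (gradK k) (x k) y / \<epsilon> k"
    if y: "y \<in> edom g" for k y
  proof -
    let ?D = "bregman (K k) (gradK k) (x k)" and ?d = "(norm (x k - x (Suc k)))\<^sup>2"
    have "m / (2 * eps_up) * ?d \<le> m / (2 * \<epsilon> k) * ?d"
      using eps(1)[of k] eps(2) eps_bounds[of k] m_pos by (intro mult_right_mono divide_left_mono) auto
    also have "\<dots> = (m / 2 * ?d) / \<epsilon> k"
      by simp
    also have "\<dots> \<le> ?D (x (Suc k)) / \<epsilon> k"
      using strongly_convex_bregman_ge[where K = "K k" and gK = "gradK k", OF K_sc K_diff, of "x (Suc k)" "x k"]
        eps(1)[of k]
      by (intro divide_right_mono) (auto simp: norm_minus_commute)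
    finally show ?thesis
      using arg_min[of k y] y by (simp add: g_gr xg inner_diff_right)
  qed
  have opt_le: "gr (x (Suc k)) \<le> gr y + gradf (x k) \<bullet> (y - x (Suc k)) + \<rho> * (norm (y - x k))\<^sup>2"
    if y: "y \<in> edom g" for k y
  proof -
    let ?d = "(norm (y - x k))\<^sup>2"
    have "bregman (K k) (gradK k) (x k) y / \<epsilon> k \<le> (M / 2 * ?d) / \<epsilon> k"
      using lipschitz_bregman_le[where K = "K k" and gK = "gradK k", OF K_diff K_lip] eps(1)[of k] by (intro divide_right_mono) auto
    also have "\<dots> \<le> (M / 2 * ?d) / eps_lo"
      using M_nonneg eps_pos eps(1)[of k] eps_bounds[of k] by (intro divide_left_mono) auto
    finally have "bregman (K k) (gradK k) (x k) y / \<epsilon> k \<le> \<rho> * ?d"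
      by (simp add: \<rho>_def)
    moreover have "0 \<le> m / (2 * eps_up) * (norm (x k - x (Suc k)))\<^sup>2"
      using m_pos eps(2) by (intro mult_nonneg_nonneg) auto
    ultimately show ?thesis
      using opt[OF y, of k] by linarith
  qed

  \<comment> \<open>Sufficient decrease of the values\<close>
  define \<Phi> where "\<Phi> k = fr (x k) + gr (x k)" for k
  \<comment> \<open>The minimisation gains \<open>m / (2 * eps_up)\<close> and the quadratic bound
    on \<open>f\<close> loses \<open>L / 2\<close>; \<open>eps_small\<close> makes the difference
    positive.\<close>
  define c where "c = (m / eps_up - L) / 2"
  have c: "0 < c"
    using eps_small L_pos eps(2) by (simp add: c_def field_simps)
  have F_\<Phi>: "F (x k) = ereal (\<Phi> k)" if "1 \<le> k" for k
    using that xg[of "k - 1"] by (simp add: F \<Phi>_def f_fr g_gr xf)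
  have dec: "\<Phi> (Suc k) + c * (norm (x k - x (Suc k)))\<^sup>2 \<le> \<Phi> k" if "1 \<le> k" for k
  proof -
    have "gr (x (Suc k)) + m / (2 * eps_up) * (norm (x k - x (Suc k)))\<^sup>2
      \<le> gr (x k) + gradf (x k) \<bullet> (x k - x (Suc k))"
      using opt[of "x k" k] xg[of "k - 1"] that by (simp add: bregman_def)
    moreover have "fr (x (Suc k))
      \<le> fr (x k) + gradf (x k) \<bullet> (x (Suc k) - x k) + L / 2 * (norm (x k - x (Suc k)))\<^sup>2"
      using fr_le[OF xf[of k] xf[of "Suc k"]] by (simp add: norm_minus_commute)
    ultimately show ?thesis
      by (simp add: \<Phi>_def c_def inner_diff_right algebra_simps diff_divide_distrib)
  qed
  have mono: "\<Phi> (Suc k) \<le> \<Phi> k" if "1 \<le> k" for k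
    using dec[OF that] c by (smt (verit) mult_nonneg_nonneg zero_le_power2)
  have anti: "\<Phi> l \<le> \<Phi> k" if "1 \<le> k" "k \<le> l" for k l
    using that(2) that(1) by (induction l rule: dec_induct) (use mono in \<open>auto intro: order_trans\<close>)

  \<comment> \<open>The accumulation point lies in both domains\<close>
  obtain r where r: "strict_mono r" and xr: "(\<lambda>j. x (r j)) \<longlonglongrightarrow> xbar"
    using accum by (auto simp: accumulation_point_def o_def)
  have r_top: "filterlim r at_top sequentially"
    using r by (rule filterlim_subseq)
  have ev_r: "eventually (\<lambda>j. k \<le> r j) sequentially" for k
    using r_top by (simp add: filterlim_at_top)
  have rg: "x (r j) \<in> edom g" if "1 \<le> r j" for j
    using xg[of "r j - 1"] that by simp
  \<comment> \<open>Lower semicontinuity bounds \<open>f\<close> and \<open>g\<close> below near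
    \<open>xbar\<close>. Their sum is at most \<open>\<Phi> 1\<close> along the iterates, so each is
    also bounded above along the subsequence, and lower semicontinuity makes both finite at
    \<open>xbar\<close>.\<close>
  have real_below: "\<exists>b::real. ereal b < \<psi> xbar" if "proper \<psi>" for \<psi> :: "real ^ 'n \<Rightarrow> ereal"
    using that by (cases "\<psi> xbar") (auto simp: proper_def intro: lt_ex)
  obtain bf bg where "ereal bf < f xbar" "ereal bg < g xbar"
    using real_below f_proper g_proper by blast
  then have "eventually (\<lambda>j. ereal bf < f (x (r j))) sequentially"
      and "eventually (\<lambda>j. ereal bg < g (x (r j))) sequentially"
    using eventually_compose_filterlim[OF lsc_eventually_gt xr] f_lsc g_lsc by blast+
  with ev_r[of 1] have ev: "eventually (\<lambda>j. 1 \<le> r j \<and> bf < fr (x (r j)) \<and> bg < gr (x (r j))) sequentially"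
    by eventually_elim (auto simp: f_fr g_gr xf rg)
  then have "\<exists>\<^sub>F j in sequentially. f (x (r j)) \<le> ereal (\<Phi> 1 - bg)"
  proof (intro eventually_frequently, goal_cases)
    case 2
    then show ?case
    proof eventually_elim
      case (elim j)
      then show ?case
        using anti[of 1 "r j"] by (simp add: f_fr xf) (simp add: \<Phi>_def)
    qed
  qed simp
  then have "f xbar \<le> ereal (\<Phi> 1 - bg)"
    by (rule lsc_le_of_frequently_le[OF f_lsc xr])
  then have bar_f: "xbar \<in> edom f"
    by (auto simp: edom_def intro: le_less_trans)
  from ev have "\<exists>\<^sub>F j in sequentially. g (x (r j)) \<le> ereal (\<Phi> 1 - bf)"
  proof (intro eventually_frequently, goal_cases)
    case 2
    then show ?case
    proof eventually_elim
      case (elim j)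
      then show ?case
        using anti[of 1 "r j"] by (simp add: g_gr rg) (simp add: \<Phi>_def)
    qed
  qed simp
  then have "g xbar \<le> ereal (\<Phi> 1 - bf)"
    by (rule lsc_le_of_frequently_le[OF g_lsc xr])
  then have bar_g: "xbar \<in> edom g"
    by (auto simp: edom_def intro: le_less_trans)
  define \<Phi>b where "\<Phi>b = fr xbar + gr xbar"
  have F_bar: "F xbar = ereal \<Phi>b"
    by (simp add: F \<Phi>b_def f_fr g_gr bar_f bar_g)

  \<comment> \<open>Identifying the limit of the values\<close>
  have "bf + bg \<le> \<Phi> (Suc k)" for k
  proof -
    have "eventually (\<lambda>j. bf + bg \<le> \<Phi> (Suc k)) sequentially"
      using ev ev_r[of "Suc k"]
    proof eventually_elim
      case (elim j)
      then show ?case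
        using anti[of "Suc k" "r j"] by (simp add: \<Phi>_def)
    qed
    then show ?thesis
      by simp
  qed
  moreover have "decseq (\<lambda>k. \<Phi> (Suc k))"
    using mono by (simp add: decseq_Suc_iff)
  ultimately obtain \<Phi>s where "(\<lambda>k. \<Phi> (Suc k)) \<longlonglongrightarrow> \<Phi>s"
    using decseq_convergent[of "\<lambda>k. \<Phi> (Suc k)" "bf + bg"] by blast
  then have \<Phi>_lim: "\<Phi> \<longlonglongrightarrow> \<Phi>s"
    by (simp only: filterlim_sequentially_Suc)
  have step0: "(\<lambda>k. x k - x (Suc k)) \<longlonglongrightarrow> 0"
  proof -
    have "(\<lambda>k. (\<Phi> k - \<Phi> (Suc k)) / c) \<longlonglongrightarrow> (\<Phi>s - \<Phi>s) / c"
      using c \<Phi>_lim by (intro tendsto_intros LIMSEQ_Suc) auto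
    then have lim0: "(\<lambda>k. (\<Phi> k - \<Phi> (Suc k)) / c) \<longlonglongrightarrow> 0"
      by simp
    have "(norm (x k - x (Suc k)))\<^sup>2 \<le> (\<Phi> k - \<Phi> (Suc k)) / c" if "1 \<le> k" for k
      using dec[OF that] by (simp add: pos_le_divide_eq[OF c] mult.commute)
    then have le: "eventually (\<lambda>k. (norm (x k - x (Suc k)))\<^sup>2 \<le> (\<Phi> k - \<Phi> (Suc k)) / c) sequentially"
      by (rule eventually_sequentiallyI)
    have "(\<lambda>k. (norm (x k - x (Suc k)))\<^sup>2) \<longlonglongrightarrow> 0"
      by (rule real_tendsto_sandwich[OF _ le tendsto_const lim0]) simp
    from tendsto_real_sqrt[OF this] show ?thesis
      by (simp add: tendsto_norm_zero_iff)
  qed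
  \<comment> \<open>Vanishing steps carry the limit over to the shifted subsequence, whose members
    are the minimisers computed from \<open>x (r j)\<close>.\<close>
  have xr': "(\<lambda>j. x (Suc (r j))) \<longlonglongrightarrow> xbar"
    using tendsto_diff[OF xr filterlim_compose[OF step0 r_top]] by simp
  have fr_lim: "(\<lambda>j. fr (x (Suc (r j)))) \<longlonglongrightarrow> fr xbar"
    using fr_cont xr' bar_f xf by (intro continuous_on_tendsto_compose[OF fr_cont]) auto
  have gradf_lim: "(\<lambda>j. gradf (x (r j))) \<longlonglongrightarrow> gradf xbar"
    using xr bar_f xf by (intro continuous_on_tendsto_compose[OF gradf_cont]) auto
  have \<Phi>r_lim: "(\<lambda>j. \<Phi> (Suc (r j))) \<longlonglongrightarrow> \<Phi>s"
    using LIMSEQ_Suc[OF \<Phi>_lim] r_top by (rule filterlim_compose)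
  have gr_lim: "(\<lambda>j. gr (x (Suc (r j)))) \<longlonglongrightarrow> \<Phi>s - fr xbar"
    using tendsto_diff[OF \<Phi>r_lim fr_lim] by (simp add: \<Phi>_def)
  \<comment> \<open>The left side is the limit of the values of \<open>g\<close>, not yet known to
    equal \<open>gr xbar\<close>. Lower semicontinuity gives one inequality between them, and
    \<open>y = xbar\<close> here gives the other.\<close>
  have limit_opt: "\<Phi>s - fr xbar \<le> gr y + gradf xbar \<bullet> (y - xbar) + \<rho> * (norm (y - xbar))\<^sup>2"
    if y: "y \<in> edom g" for y
  proof (rule LIMSEQ_le[OF gr_lim])
    show "(\<lambda>j. gr y + gradf (x (r j)) \<bullet> (y - x (Suc (r j))) + \<rho> * (norm (y - x (r j)))\<^sup>2)
        \<longlonglongrightarrow> gr y + gradf xbar \<bullet> (y - xbar) + \<rho> * (norm (y - xbar))\<^sup>2"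
      by (intro tendsto_intros gradf_lim xr xr')
  qed (use opt_le[OF y] in auto)
  have "g xbar \<le> ereal (\<Phi>s - fr xbar)"
  proof (rule ereal_le_epsilon2)
    fix e :: real assume "0 < e"
    then have "eventually (\<lambda>j. gr (x (Suc (r j))) < \<Phi>s - fr xbar + e) sequentially"
      using gr_lim by (intro order_tendstoD) auto
    then have "eventually (\<lambda>j. g (x (Suc (r j))) \<le> ereal (\<Phi>s - fr xbar + e)) sequentially"
      by eventually_elim (simp add: g_gr xg)
    then have "\<exists>\<^sub>F j in sequentially. g (x (Suc (r j))) \<le> ereal (\<Phi>s - fr xbar + e)"
      by (intro eventually_frequently) simp
    then have "g xbar \<le> ereal (\<Phi>s - fr xbar + e)"
      by (rule lsc_le_of_frequently_le[OF g_lsc xr'])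
    then show "g xbar \<le> ereal (\<Phi>s - fr xbar) + ereal e"
      by simp
  qed
  then have \<Phi>s: "\<Phi>s = \<Phi>b"
    using limit_opt[OF bar_g] by (simp add: g_gr bar_g \<Phi>b_def)

  \<comment> \<open>Convergence rates\<close>
  have rate: "(\<exists>\<beta> k0. 0 < \<beta> \<and> \<beta> < 1 \<and> 1 \<le> k0 \<and> (\<forall>k\<ge>k0. \<Phi> (Suc k) - \<Phi>b \<le> \<beta> * (\<Phi> k - \<Phi>b)))
      \<and> r_linear_conv x xbar"
  proof (rule error_bound_linear_convergence[OF c pos _ _ accum])
    show "(\<lambda>k. \<Phi> k - \<Phi>b) \<longlonglongrightarrow> 0"
      using \<Phi>_lim \<Phi>s by (simp add: LIM_zero)
    fix k :: nat assume k: "1 \<le> k"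
    show "\<Phi> (Suc k) - \<Phi>b + c * (norm (x k - x (Suc k)))\<^sup>2 \<le> \<Phi> k - \<Phi>b"
      using dec[OF k] by simp
    assume "x (Suc k) \<in> ball xbar \<eta>" "0 < \<Phi> (Suc k) - \<Phi>b" "\<Phi> (Suc k) - \<Phi>b < \<nu>"
    then have "x (Suc k) \<in> value_ball F xbar \<eta> \<nu>"
      by (simp add: value_ball_def F_\<Phi> F_bar)
    then have "F (x (Suc k)) - F xbar \<le> ereal (\<kappa> * (norm (x k - x (Suc k)))\<^sup>2)"
      using eb unfolding vp_eb_def by blast
    then show "\<Phi> (Suc k) - \<Phi>b \<le> \<kappa> * (norm (x k - x (Suc k)))\<^sup>2"
      by (simp add: F_\<Phi> F_bar)
  qed
  then have Q: "\<exists>\<beta> k0. 0 < \<beta> \<and> \<beta> < 1 \<and>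
      (\<forall>k\<ge>k0. F (x (Suc k)) - F xbar \<le> ereal \<beta> * (F (x k) - F xbar))"
    by (fastforce simp: F_\<Phi> F_bar)
  have "(\<lambda>k. ereal (\<Phi> k)) \<longlonglongrightarrow> F xbar"
    using \<Phi>_lim \<Phi>s by (simp add: F_bar)
  moreover have "eventually (\<lambda>k. ereal (\<Phi> k) = F (x k)) sequentially"
    by (rule eventually_sequentiallyI[of 1]) (simp add: F_\<Phi>)
  ultimately have F_lim: "(\<lambda>k. F (x k)) \<longlonglongrightarrow> F xbar"
    by (rule Lim_transform_eventually)

  \<comment> \<open>Proximal criticality\<close>
  have "F xbar + ereal (0 \<bullet> (y - xbar)) - ereal ((L / 2 + \<rho>) * (norm (y - xbar))\<^sup>2) \<le> F y" for y
  proof (cases "y \<in> edom f \<and> y \<in> edom g")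
    case True
    \<comment> \<open>Adding the lower quadratic bound for \<open>f\<close> to
      \<open>limit_opt\<close> cancels the terms linear in \<open>y - xbar\<close>.\<close>
    then have "\<Phi>b - (L / 2 + \<rho>) * (norm (y - xbar))\<^sup>2 \<le> fr y + gr y"
      using fr_ge[OF bar_f, of y] limit_opt[of y] \<Phi>s by (simp add: \<Phi>b_def distrib_right)
    then show ?thesis
      using True by (simp add: F_bar) (simp add: F f_fr g_gr)
  next
    case False
    then have "F y = \<infinity>"
      using f_proper g_proper by (auto simp: F edom_def proper_def)
    then show ?thesis
      by simp
  qed
  moreover have "0 < L / 2 + \<rho>"
    using L_pos \<rho> by simp
  moreover have "xbar \<in> edom F"
    by (simp add: edom_def F_bar)
  ultimately have "prox_critical F xbar"
    \<comment> \<open>The minorant is global, so the radius 1 serves as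
      \<open>\<delta>\<close>.\<close>
    unfolding prox_critical_def prox_subdiff_def using zero_less_one[where 'a = real] by blast
  then show ?thesis
    using F_lim Q rate by blast
qed

end
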